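(* Let $\theta \in \Theta$ be arbitrary and suppose the input sequence $\{u_{t|t},\ldots,u_{t+N|t}\}$ is feasible for the optimization problem $V_N(x_t,\theta,t)$. If $\Omega$ is a maximal output admissible disturbance invariant set, then applying the input $u_t = u_{t|t}$ to the true system $x_{t+1} = Ax_t + Bu_t + g(x_t,u_t,\theta_0)$ ensures that: (a) (robust constraint satisfaction) $x_{t+1}\in\mathcal{X}$; and (b) (robust feasibility) there exist values $\{u_{t+1|t+1},\ldots,u_{t+1+N|t+1}\}$ that are feasible for $V_N(x_{t+1},\theta',t+1)$ for any $\theta'\in\Theta$.
   Context: States $x_t\in\mathbb{R}^n$ and inputs $u_t\in\mathbb{R}^q$ are constrained by compact polytopes $\mathcal{X}\subset\mathbb{R}^n$, $\mathcal{U}\subset\mathbb{R}^q$. The true dynamics are $x_{t+1} = f(x_t,u_t,\theta_0) = Ax_t+Bu_t+g(x_t,u_t,\theta_0)$ with $A\in\mathbb{R}^{n\times n}$, $B\in\mathbb{R}^{n\times q}$, $\theta_0\in\Theta$ for a compact $\Theta\subseteq\mathbb{R}^p$, and $g(\cdot,\cdot,\theta):\mathbb{R}^n\times\mathbb{R}^q\to\mathbb{R}^n$. It is assumed that $\{g(x,u,\theta_0): x\in\mathcal{X},u\in\mathcal{U}\}\subseteq\mathcal{W}$ for a bounded polytope $\mathcal{W}$, and that $(A,B)$ is stabilizable. Set operations: $\mathcal{A}\oplus\mathcal{B}=\{a+b: a\in\mathcal{A}, b\in\mathcal{B}\}$ (Minkowski sum) and $\mathcal{A}\ominus\mathcal{B}=\{a: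 a+\mathcal{B}\subseteq\mathcal{A}\}$ (Pontryagin difference). $\Omega\subseteq\mathcal{X}$ being a maximal output admissible disturbance invariant set means that for some $K\in\mathbb{R}^{q\times n}$ such that $A+BK$ is Schur stable: (i) $\Omega\subseteq\{\bar{x}\in\mathcal{X}: K\bar{x}\in\mathcal{U}\}$ (constraint satisfaction), and (ii) $(A+BK)\Omega\oplus\mathcal{W}\subseteq\Omega$ (disturbance invariance). For a horizon $N$, $h$ is the expected reward function $h(x,u,\theta)$, and $V_N(x_t,\theta,t)$ is the value of the problem $$\max \sum_{k=0}^{N} h(\tilde{x}_{t+k|t},u_{t+k|t},\theta)$$ over $u_{t|t},\ldots,u_{t+N|t}$, subject to: $\bar{x}_{t+k+1|t}=A\bar{x}_{t+k|t}+Bu_{t+k|t}$ for $k\in\{0,\ldots,N-1\}$; $\tilde{x}_{t+k+1|t}=A\tilde{x}_{t+k|t}+Bu_{t+k|t}+g(\tilde{x}_{t+k|t},u_{t+k|t},\theta)$ for $k\in\{0,\ldots,N-1\}$; $\bar{x}_{t+k|t}\in\mathcal{X}$ for $k\in\{1,\ldots,N\}$; $u_{t+k|t}\in\mathcal{U}$ for $k\in\{0,\ldots,N\}$; $\bar{x}_{t+1|t}\in\Omega\ominus\mathcal{W}$; and $\bar{x}_{t|t}=\tilde{x}_{t|t}=x_t$. A sequence of inputs is feasible for $V_N(x_t,\theta,t)$ if it satisfies these constraints.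
   Formalization: Part (b) is proved under the added assumption that W contains the origin (it fails otherwise, e.g. A=1/2, B=0, g=1, W={1}, U={0}, X=Ω=[1.05,3], N=1, x_t=2.125); the horizon is N≥1, since for N=0 the state x̄_{t+1|t} is not defined by the dynamics. *)

theory Defs
  imports "HOL-Analysis.Analysis"
begin

text \<open>
  The Minkowski sum of two sets is \<open>(+)\<close> on sets, from \<open>HOL-Library.Set_Algebras\<close>.
\<close>

definition pontryagin_diff :: "'a::plus set \<Rightarrow> 'a set \<Rightarrow> 'a set"  (infixl "\<ominus>" 65)
  where "S \<ominus> T = {a. (\<lambda>b. a + b) ` T \<subseteq> S}"

text \<open>
  Pitfall: \<open>S \<ominus> T \<subseteq> S\<close> can fail when \<open>0 \<notin> T\<close>, so a nominal state in \<open>\<Omega> \<ominus> W\<close> need not satisfy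
  the state constraints unless \<open>0 \<in> W\<close>.
\<close>

text \<open>
  Eigenvalues range over the complex numbers, so the real matrix is complexified first.
\<close>

definition complex_eigenvalue :: "real^'n^'n \<Rightarrow> complex \<Rightarrow> bool"
  where "complex_eigenvalue M \<mu> \<longleftrightarrow> (\<exists>v. v \<noteq> 0 \<and> map_matrix complex_of_real M *v v = \<mu> *s v)"

definition schur_stable :: "real^'n^'n \<Rightarrow> bool"
  where "schur_stable M \<longleftrightarrow> (\<forall>\<mu>. complex_eigenvalue M \<mu> \<longrightarrow> cmod \<mu> < 1)"

definition stabilizable :: "real^'n^'n \<Rightarrow> real^'q^'n \<Rightarrow> bool"
  where "stabilizable A B \<longleftrightarrow> (\<exists>K :: real^'n^'q. schur_stable (A + B ** K))"

text \<open>
  \<open>max_output_admissible_dist_inv A B X U W \<Omega>\<close>: the conditions imposed on the terminal set.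
  Despite the traditional name, they do not require \<open>\<Omega>\<close> to be the largest such set.
\<close>

definition max_output_admissible_dist_inv ::
    "real^'n^'n \<Rightarrow> real^'q^'n \<Rightarrow> (real^'n) set \<Rightarrow> (real^'q) set \<Rightarrow> (real^'n) set \<Rightarrow> (real^'n) set \<Rightarrow> bool"
  where "max_output_admissible_dist_inv A B X U W \<Omega> \<longleftrightarrow>
    \<Omega> \<subseteq> X \<and>
    (\<exists>K :: real^'n^'q. schur_stable (A + B ** K) \<and>
       \<Omega> \<subseteq> {x \<in> X. K *v x \<in> U} \<and>
       (\<lambda>x. (A + B ** K) *v x) ` \<Omega> + W \<subseteq> \<Omega>)"

text \<open>
  Feasibility of an input sequence for the problem \<open>V_N(x, \<theta>, t)\<close>. Here \<open>u (t + k)\<close> is the input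
  planned at time \<open>t\<close> for time \<open>t + k\<close>, and likewise for the nominal prediction \<open>xbar\<close> (which
  carries the state constraints) and the learned prediction \<open>xtil\<close> (which enters the reward).
  Only the values of \<open>u\<close> at times \<open>t, \<dots>, t + N\<close> matter. The reward function occurs only in
  the objective and hence not here. For \<open>N = 0\<close> the constraint on \<open>xbar (t + 1)\<close> would not be
  tied to the dynamics; the problem is meaningful for \<open>N \<ge> 1\<close>.
\<close>

definition mpc_feasible ::
    "real^'n^'n \<Rightarrow> real^'q^'n \<Rightarrow> (real^'n \<Rightarrow> real^'q \<Rightarrow> real^'p \<Rightarrow> real^'n) \<Rightarrow>
     (real^'n) set \<Rightarrow> (real^'q) set \<Rightarrow> (real^'n) set \<Rightarrow> (real^'n) set \<Rightarrow>
     nat \<Rightarrow> real^'n \<Rightarrow> real^'p \<Rightarrow> nat \<Rightarrow> (nat \<Rightarrow> real^'q) \<Rightarrow> bool"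
  where "mpc_feasible A B g X U W \<Omega> N x \<theta> t u \<longleftrightarrow>
    (\<exists>xbar xtil :: nat \<Rightarrow> real^'n.
       xbar t = x \<and> xtil t = x \<and>
       (\<forall>k<N. xbar (t + k + 1) = A *v xbar (t + k) + B *v u (t + k)) \<and>
       (\<forall>k<N. xtil (t + k + 1) =
                A *v xtil (t + k) + B *v u (t + k) + g (xtil (t + k)) (u (t + k)) \<theta>) \<and>
       (\<forall>k\<in>{1..N}. xbar (t + k) \<in> X) \<and>
       (\<forall>k\<le>N. u (t + k) \<in> U) \<and>
       xbar (t + 1) \<in> \<Omega> \<ominus> W)"

end

theory Submission
  imports Defs
begin

text \<open>
  The true successor is the nominal successor plus a disturbance in \<open>W\<close>, so the constraint
  \<open>xbar (t + 1) \<in> \<Omega> \<ominus> W\<close> puts it in \<open>\<Omega>\<close>. From there the terminal feedback \<open>K\<close> supplies the new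
  inputs: since \<open>0 \<in> W\<close>, the closed loop maps \<open>\<Omega>\<close> to itself, so the nominal trajectory never
  leaves \<open>\<Omega>\<close>. These inputs do not depend on the parameter, which enters only the unconstrained
  learned prediction.
\<close>

lemma pontryagin_diff_add_mem:
  assumes "a \<in> S \<ominus> T" and "b \<in> T"
  shows "a + b \<in> S"
  using assms unfolding pontryagin_diff_def by auto

lemma pontryagin_diff_memI:
  assumes "\<And>b. b \<in> T \<Longrightarrow> a + b \<in> S"
  shows "a \<in> S \<ominus> T"
  using assms unfolding pontryagin_diff_def by auto

text \<open>Since \<open>N \<ge> 1\<close>, the dynamics identify \<open>xbar (t + 1)\<close> with
  the nominal successor of \<open>x\<close>; the tightening by \<open>W\<close> then absorbs any
  \<open>w\<close>, in particular the true value of \<open>g\<close>.\<close>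

lemma mpc_feasible_imp_dist_inv_successor:
  assumes "mpc_feasible A B g X U W \<Omega> N x \<theta> t u" and "N \<ge> 1"
    and "w \<in> W"
  shows "A *v x + B *v u t + w \<in> \<Omega>"
proof -
  obtain xbar where init: "xbar t = x"
    and dyn: "\<And>k. k < N \<Longrightarrow> xbar (t + k + 1) = A *v xbar (t + k) + B *v u (t + k)"
    and succ: "xbar (t + 1) \<in> \<Omega> \<ominus> W"
    using assms(1) unfolding mpc_feasible_def by blast
  have "xbar (t + 1) = A *v x + B *v u t"
    using dyn[of 0] init \<open>N \<ge> 1\<close> by simp
  with succ show ?thesis
    using pontryagin_diff_add_mem \<open>w \<in> W\<close> by metis
qed

lemma mpc_feasible_linear_feedback:
  fixes A :: "real^'n^'n" and B :: "real^'q^'n" and K :: "real^'n^'q"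
    and t :: nat and x :: "real^'n"
  defines "xbar \<equiv> \<lambda>s. (((*v) (A + B ** K)) ^^ (s - t)) x"
  assumes adm: "\<Omega> \<subseteq> {y \<in> X. K *v y \<in> U}"
    and inv: "(\<lambda>y. (A + B ** K) *v y) ` \<Omega> + W \<subseteq> \<Omega>"
    and "0 \<in> W" and "x \<in> \<Omega>"
  shows "mpc_feasible A B g X U W \<Omega> N x \<theta> t (\<lambda>s. K *v xbar s)"
proof -
  \<comment> \<open>The inputs feed back the nominal state, not the learned state \<open>z\<close>,
    so \<theta> affects \<open>xtil\<close> but not the inputs. The recursion counts steps from time
    \<open>t\<close>.\<close>
  define xtil where "xtil = (\<lambda>s. rec_nat x
      (\<lambda>k z. A *v z + B *v (K *v xbar (t + k)) + g z (K *v xbar (t + k)) \<theta>) (s - t))"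
  have step: "(A + B ** K) *v y + w \<in> \<Omega>" if "y \<in> \<Omega>" "w \<in> W" for y w
    using inv that by blast
  have bar_Suc: "xbar (t + k + 1) = (A + B ** K) *v xbar (t + k)" for k
    by (simp add: xbar_def)
  have bar_mem: "xbar (t + k) \<in> \<Omega>" for k
  proof (induction k)
    case 0
    show ?case using \<open>x \<in> \<Omega>\<close> by (simp add: xbar_def)
  next
    case (Suc k)
    \<comment> \<open>The nominal step is the disturbed one with \<open>w = 0\<close>.\<close>
    with step[OF Suc \<open>0 \<in> W\<close>] show ?case
      using bar_Suc[of k] by simp
  qed
  show ?thesis
    unfolding mpc_feasible_def
  proof (rule exI[of _ xbar], rule exI[of _ xtil], intro conjI allI ballI impI)
    show "xbar t = x" "xtil t = x"
      by (simp_all add: xbar_def xtil_def)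
    show "xbar (t + k + 1) = A *v xbar (t + k) + B *v (K *v xbar (t + k))" for k
      unfolding bar_Suc by (simp add: matrix_vector_mult_add_rdistrib matrix_vector_mul_assoc)
    show "xtil (t + k + 1) = A *v xtil (t + k) + B *v (K *v xbar (t + k)) +
        g (xtil (t + k)) (K *v xbar (t + k)) \<theta>" for k
      by (simp add: xtil_def)
    show "xbar (t + k) \<in> X" "K *v xbar (t + k) \<in> U" for k
      using bar_mem[of k] adm by auto
    show "xbar (t + 1) \<in> \<Omega> \<ominus> W"
      \<comment> \<open>Here invariance is used for every \<open>w \<in> W\<close>, with
        \<open>xbar (t + 1)\<close> being one closed-loop step from \<open>x\<close>.\<close>
      using step[OF \<open>x \<in> \<Omega>\<close>] by (intro pontryagin_diff_memI) (simp add: xbar_def)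
  qed
qed

theorem theorem1:
  fixes A :: "real^'n^'n" and B :: "real^'q^'n"
    and g :: "real^'n \<Rightarrow> real^'q \<Rightarrow> real^'p \<Rightarrow> real^'n"
    and X W \<Omega> :: "(real^'n) set" and U :: "(real^'q) set"
    and \<Theta> :: "(real^'p) set" and \<theta>0 \<theta> :: "real^'p"
    and N t :: nat and u :: "nat \<Rightarrow> real^'q" and x x_next :: "real^'n"
  assumes "polytope X" and "polytope U" and "polytope W"
    and "compact \<Theta>" and "\<theta>0 \<in> \<Theta>"
    and "{g y v \<theta>0 | y v. y \<in> X \<and> v \<in> U} \<subseteq> W"
    and "stabilizable A B"
    and "max_output_admissible_dist_inv A B X U W \<Omega>"
    and "N \<ge> 1"
    and "x \<in> X"
    and "\<theta> \<in> \<Theta>"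
    and "mpc_feasible A B g X U W \<Omega> N x \<theta> t u"
    and "x_next = A *v x + B *v u t + g x (u t) \<theta>0"
  shows "x_next \<in> X \<and>
    (0 \<in> W \<longrightarrow>
      (\<exists>u'. \<forall>\<theta>'\<in>\<Theta>. mpc_feasible A B g X U W \<Omega> N x_next \<theta>' (t + 1) u'))"
proof -
  obtain K :: "real^'n^'q" where adm: "\<Omega> \<subseteq> {y \<in> X. K *v y \<in> U}"
    and inv: "(\<lambda>y. (A + B ** K) *v y) ` \<Omega> + W \<subseteq> \<Omega>"
    using assms(8) unfolding max_output_admissible_dist_inv_def by blast
  have "\<forall>k\<le>N. u (t + k) \<in> U"
    using assms(12) unfolding mpc_feasible_def by blast
  then have "u t \<in> U"
    by (metis add_0_right le0)
  then have "g x (u t) \<theta>0 \<in> W"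
    using assms(6) \<open>x \<in> X\<close> by blast
  then have next_mem: "x_next \<in> \<Omega>"
    using mpc_feasible_imp_dist_inv_successor assms(9,12,13) by metis
  \<comment> \<open>One \<open>u'\<close> can precede the quantifier over \<theta>' because the
    feedback inputs from \<open>x_next\<close> do not mention the parameter.\<close>
  moreover have "\<exists>u'. \<forall>\<theta>'\<in>\<Theta>. mpc_feasible A B g X U W \<Omega> N x_next \<theta>' (t + 1) u'" if "0 \<in> W"
    using mpc_feasible_linear_feedback[OF adm inv that next_mem] by blast
  ultimately show ?thesis
    using adm by blast
qed

end
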